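(* Let $K$ be a field of characteristic $p>0$ and let $A\to B$ be an injective smooth morphism of finitely generated $K$-algebras. Regard $W(A)$ as a subring of $W(B)$ via the induced injective homomorphism $W(A)\to W(B)$. Then $$W(A)\cap W^{\dagger}(B)=W^{\dagger}(A).$$
   Context: Rings are commutative with $1$; $W(-)$ denotes $p$-typical Witt vectors. A pseudovaluation on a ring $A$ is a function $\nu:A\to\mathbb R\cup\{\pm\infty\}$ with $\nu(0)=\infty$, $\nu(1)=0$, $\nu(a\pm b)\ge\min\{\nu(a),\nu(b)\}$, and $\nu(ab)\ge\nu(a)+\nu(b)$ whenever $\nu(a),\nu(b)\ne-\infty$. It is proper if it never takes the value $-\infty$, and negative if it is proper and $\nu(a)\le 0$ for all $a\ne 0$. Two functions $\nu_1,\nu_2:A\to\mathbb R\cup\{\infty\}$ are linearly equivalent if there are real numbers $c_1,c_2>0$, $d_1,d_2\ge0$ with $\nu_1(a)\ge c_2\nu_2(a)-d_2$ and $\nu_2(a)\ge c_1\nu_1(a)-d_1$ for all $a\in A$. Admissible pseudovaluations on a finitely generated $K$-algebra $A$: give $K$ the trivial valuation ($\mu(c)=0$ for $c\neq0$, $\mu(0)=\infty$). For a surjection of $K$-algebras $\phi:K[T_1,\dots,T_m]\to A$ and real numbers $d_1,\dots,d_m>0$ put $\nu(\sum_k c_kT^k)=\min_k\{\mu(c_k)-k_1d_1-\dots-k_md_m\}$ and $\bar\nu(a)=\sup\{\nu(f): \phi(f)=a\}$. Up to linear equivalence $\bar\nu$ is independent of the choices. A negative pseudovaluation on $A$ is called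 admissible if it is linearly equivalent to such a $\bar\nu$. Overconvergent Witt vectors: choose an admissible pseudovaluation $\nu$ on $A$. For $\varepsilon>0$ and $\alpha=(a_0,a_1,\dots)\in W(A)$ let $\gamma_\varepsilon(\alpha)=\inf_i\{i+\varepsilon p^{-i}\nu(a_i)\}$. Then $W^\varepsilon(A)=\{\alpha\in W(A):\gamma_\varepsilon(\alpha)\ne-\infty\}$ and $W^\dagger(A)=\bigcup_{\varepsilon>0}W^\varepsilon(A)$. The ring $W^\dagger(A)$ does not depend on the choice of the admissible pseudovaluation. The same definitions apply to $B$. *)

theory Defs
  imports
    "HOL-Library.Poly_Mapping"
    "HOL-Library.Extended_Real"
    "HOL-Algebra.QuotRing"
    "HOL-Algebra.Algebraic_Closure_Type"
begin

text \<open>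
  Commutative rings are types of class \<^class>\<open>comm_ring_1\<close>; \<^const>\<open>ring_of_type_algebra\<close> turns such
  a type into a ring record, so that homomorphisms are elements of \<^const>\<open>ring_hom\<close>.  The class
  excludes the zero ring, which carries no pseudovaluation.  An \<open>R\<close>-algebra is given by its
  structure homomorphism.
\<close>

section \<open>Polynomial rings and finitely generated algebras\<close>

type_synonym 'r mpoly = "(nat \<Rightarrow>\<^sub>0 nat) \<Rightarrow>\<^sub>0 'r"

text \<open>The ring of polynomials in the variables with index less than \<open>m\<close>.\<close>

definition mpoly_ring :: "nat \<Rightarrow> ('r::comm_ring_1) mpoly ring" where
  "mpoly_ring m =
     (ring_of_type_algebra :: 'r mpoly ring)
       \<lparr>carrier := {f. \<forall>k \<in> Poly_Mapping.keys f. Poly_Mapping.keys k \<subseteq> {..<m}}\<rparr>"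

text \<open>\<open>\<pi>\<close> is only meaningful on the carrier of the polynomial ring;
  \<^term>\<open>Poly_Mapping.single 0 c\<close> is the constant polynomial \<open>c\<close>.\<close>

definition poly_surjection ::
  "('r::comm_ring_1 \<Rightarrow> 'a::comm_ring_1) \<Rightarrow> nat \<Rightarrow> ('r mpoly \<Rightarrow> 'a) \<Rightarrow> bool" where
  "poly_surjection \<iota> m \<pi> \<longleftrightarrow>
     \<pi> \<in> ring_hom (mpoly_ring m) ring_of_type_algebra \<and>
     (\<forall>c. \<pi> (Poly_Mapping.single 0 c) = \<iota> c) \<and>
     \<pi> ` carrier (mpoly_ring m) = UNIV"

definition fg_algebra :: "('r::comm_ring_1 \<Rightarrow> 'a::comm_ring_1) \<Rightarrow> bool" where
  "fg_algebra \<iota> \<longleftrightarrow>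
     \<iota> \<in> ring_hom ring_of_type_algebra ring_of_type_algebra \<and>
     (\<exists>m \<pi>. poly_surjection \<iota> m \<pi>)"

section \<open>Smooth homomorphisms\<close>

definition finitely_presented :: "('a::comm_ring_1 \<Rightarrow> 'b::comm_ring_1) \<Rightarrow> bool" where
  "finitely_presented \<phi> \<longleftrightarrow>
     \<phi> \<in> ring_hom ring_of_type_algebra ring_of_type_algebra \<and>
     (\<exists>m \<pi> S. poly_surjection \<phi> m \<pi> \<and> finite S \<and> S \<subseteq> carrier (mpoly_ring m) \<and>
        a_kernel (mpoly_ring m) ring_of_type_algebra \<pi> = genideal (mpoly_ring m) S)"

text \<open>
  The infinitesimal lifting property: for every commutative ring \<open>C\<close> with an ideal \<open>N\<close> of square
  zero, every commutative square
  \<open>A \<rightarrow> C\<close>, \<open>B \<rightarrow> C/N\<close> has a diagonal filler \<open>B \<rightarrow> C\<close>.  The test rings \<open>C\<close> have their carrier in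
  the type \<open>'c\<close>.
\<close>

definition formally_smooth ::
  "'c itself \<Rightarrow> ('a::comm_ring_1 \<Rightarrow> 'b::comm_ring_1) \<Rightarrow> bool" where
  "formally_smooth (_ :: 'c itself) \<phi> \<longleftrightarrow>
     (\<forall>(C :: 'c ring) N u v.
        cring C \<longrightarrow> ideal N C \<longrightarrow> (\<forall>x \<in> N. \<forall>y \<in> N. x \<otimes>\<^bsub>C\<^esub> y = \<zero>\<^bsub>C\<^esub>) \<longrightarrow>
        u \<in> ring_hom ring_of_type_algebra C \<longrightarrow>
        v \<in> ring_hom ring_of_type_algebra (C Quot N) \<longrightarrow>
        (\<forall>a. v (\<phi> a) = N +>\<^bsub>C\<^esub> u a) \<longrightarrow>
        (\<exists>w \<in> ring_hom ring_of_type_algebra C.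
           (\<forall>a. w (\<phi> a) = u a) \<and> (\<forall>b. N +>\<^bsub>C\<^esub> w b = v b)))"

text \<open>
  Smooth means finitely presented and formally smooth.  HOL cannot quantify over the types of the
  test rings inside a definition, but one type is enough: if \<open>b\<^sub>1, \<dots>, b\<^sub>m\<close> generate the
  \<open>A\<close>-algebra \<open>B\<close> and \<open>c\<^sub>i \<in> C\<close> lifts \<open>v b\<^sub>i\<close>, then the problem \<open>(C, N, u, v)\<close> restricts to the
  subring \<open>C'\<close> generated by \<open>u(A)\<close> and the \<open>c\<^sub>i\<close>, with the ideal \<open>N \<inter> C'\<close>.  This \<open>C'\<close> is a
  quotient of \<open>A[T\<^sub>1, \<dots>, T\<^sub>m]\<close>, so it is isomorphic to a ring whose elements are
  sets (cosets) of polynomials over \<open>A\<close>.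
\<close>

definition smooth_hom :: "('a::comm_ring_1 \<Rightarrow> 'b::comm_ring_1) \<Rightarrow> bool" where
  "smooth_hom \<phi> \<longleftrightarrow>
     finitely_presented \<phi> \<and> formally_smooth TYPE('a mpoly set) \<phi>"

section \<open>Pseudovaluations\<close>

definition pseudovaluation :: "('a::comm_ring_1 \<Rightarrow> ereal) \<Rightarrow> bool" where
  "pseudovaluation \<nu> \<longleftrightarrow>
     \<nu> 0 = \<infinity> \<and> \<nu> 1 = 0 \<and>
     (\<forall>a b. \<nu> (a + b) \<ge> min (\<nu> a) (\<nu> b)) \<and>
     (\<forall>a b. \<nu> (a - b) \<ge> min (\<nu> a) (\<nu> b)) \<and>
     (\<forall>a b. \<nu> a \<noteq> -\<infinity> \<and> \<nu> b \<noteq> -\<infinity> \<longrightarrow> \<nu> (a * b) \<ge> \<nu> a + \<nu> b)"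

definition proper_pseudovaluation :: "('a::comm_ring_1 \<Rightarrow> ereal) \<Rightarrow> bool" where
  "proper_pseudovaluation \<nu> \<longleftrightarrow> pseudovaluation \<nu> \<and> (\<forall>a. \<nu> a \<noteq> -\<infinity>)"

definition negative_pseudovaluation :: "('a::comm_ring_1 \<Rightarrow> ereal) \<Rightarrow> bool" where
  "negative_pseudovaluation \<nu> \<longleftrightarrow>
     proper_pseudovaluation \<nu> \<and> (\<forall>a. a \<noteq> 0 \<longrightarrow> \<nu> a \<le> 0)"

definition linearly_equivalent :: "('a \<Rightarrow> ereal) \<Rightarrow> ('a \<Rightarrow> ereal) \<Rightarrow> bool" where
  "linearly_equivalent \<nu>1 \<nu>2 \<longleftrightarrow>
     (\<exists>c1 c2 d1 d2 :: real. c1 > 0 \<and> c2 > 0 \<and> d1 \<ge> 0 \<and> d2 \<ge> 0 \<and>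
        (\<forall>a. \<nu>1 a \<ge> ereal c2 * \<nu>2 a - ereal d2 \<and> \<nu>2 a \<ge> ereal c1 * \<nu>1 a - ereal d1))"

definition trivial_valuation :: "'k::field \<Rightarrow> ereal" where
  "trivial_valuation c = (if c = 0 then \<infinity> else 0)"

text \<open>
  The infimum ranges over all exponents, but only the finitely many in the support of \<open>f\<close> give a
  value different from \<open>\<infinity>\<close>; so it is a minimum, and it is \<open>\<infinity>\<close> for \<open>f = 0\<close>.
\<close>

definition weighted_degree_pv :: "nat \<Rightarrow> (nat \<Rightarrow> real) \<Rightarrow> ('k::field) mpoly \<Rightarrow> ereal" where
  "weighted_degree_pv m d f =
     (INF k. trivial_valuation (Poly_Mapping.lookup f k)
               - ereal (\<Sum>i<m. real (Poly_Mapping.lookup k i) * d i))"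

definition quotient_pv ::
  "nat \<Rightarrow> (nat \<Rightarrow> real) \<Rightarrow> (('k::field) mpoly \<Rightarrow> 'a) \<Rightarrow> 'a \<Rightarrow> ereal" where
  "quotient_pv m d \<pi> a =
     (SUP f \<in> {f \<in> carrier (mpoly_ring m). \<pi> f = a}. weighted_degree_pv m d f)"

definition admissible ::
  "('k::field \<Rightarrow> 'a::comm_ring_1) \<Rightarrow> ('a \<Rightarrow> ereal) \<Rightarrow> bool" where
  "admissible \<iota> \<nu> \<longleftrightarrow>
     negative_pseudovaluation \<nu> \<and>
     (\<exists>m \<pi> d. poly_surjection \<iota> m \<pi> \<and> (\<forall>i<m. d i > 0) \<and>
        linearly_equivalent \<nu> (quotient_pv m d \<pi>))"

section \<open>Overconvergent Witt vectors\<close>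

text \<open>
  A \<open>p\<close>-typical Witt vector is identified with its sequence of components \<open>(a\<^sub>0, a\<^sub>1, \<dots>)\<close>, and
  \<open>W(\<phi>)\<close> acts componentwise.  Overconvergence is a condition on the components alone, so the ring
  operations of \<open>W(A)\<close> are not needed to describe \<open>W\<^sup>\<dagger>(A)\<close> as a subset of \<open>W(A)\<close>.
\<close>

type_synonym 'a witt = "nat \<Rightarrow> 'a"

definition witt_map :: "('a \<Rightarrow> 'b) \<Rightarrow> 'a witt \<Rightarrow> 'b witt" where
  "witt_map \<phi> \<alpha> = (\<lambda>i. \<phi> (\<alpha> i))"

definition gauss_norm :: "nat \<Rightarrow> ('a \<Rightarrow> ereal) \<Rightarrow> real \<Rightarrow> 'a witt \<Rightarrow> ereal" where
  "gauss_norm p \<nu> \<epsilon> \<alpha> = (INF i. ereal (real i) + ereal (\<epsilon> / real p ^ i) * \<nu> (\<alpha> i))"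

definition witt_radius :: "nat \<Rightarrow> ('a \<Rightarrow> ereal) \<Rightarrow> real \<Rightarrow> 'a witt set" where
  "witt_radius p \<nu> \<epsilon> = {\<alpha>. gauss_norm p \<nu> \<epsilon> \<alpha> \<noteq> -\<infinity>}"

text \<open>\<open>\<nu>\<close> is the chosen admissible pseudovaluation.\<close>

definition overconvergent_witt :: "nat \<Rightarrow> ('a \<Rightarrow> ereal) \<Rightarrow> 'a witt set" where
  "overconvergent_witt p \<nu> = (\<Union>\<epsilon> \<in> {0<..}. witt_radius p \<nu> \<epsilon>)"

end

theory Submission
  imports Defs
begin

text \<open>
  Overconvergence of \<open>\<alpha>\<close> says that \<open>\<nu> (\<alpha> i)\<close> is at least \<open>- const \<cdot> p\<^sup>i \<cdot> (i + const)\<close>, so it is not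
  affected when \<open>\<nu>\<close> is replaced by a function with a lower bound that is linear in \<open>\<nu>\<close>
  (\<open>overconvergent_witt_mono\<close>).  The theorem therefore follows once
  \<open>\<nu>A\<close> and \<open>\<nu>B \<circ> \<phi>\<close> are shown to bound each other linearly on \<open>A\<close>.  Up to linear
  equivalence, \<open>- \<nu> a\<close> is the least degree of a polynomial in fixed generators that represents
  \<open>a\<close>.  One bound is substitution: a polynomial of degree \<open>n\<close> in the generators of \<open>A\<close> becomes a
  polynomial of degree \<open>O(n)\<close> in those of \<open>B\<close>.

  The other bound (\<open>admissible_descent_bounded_below\<close>) is an effective elimination.  Let \<open>b\<close> in the image
  of \<open>A\<close> be a polynomial of degree \<open>n\<close> in the generators \<open>y\<close> of \<open>B\<close>.  Adjoin the images of the
  generators \<open>t\<close> of \<open>A\<close> to those of \<open>B\<close> and order all monomials lexicographically with every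
  \<open>y\<close> above every \<open>t\<close>.  Rewriting \<open>b\<close> by a Groebner basis of the relations leads
  to a polynomial in the \<open>t\<close> alone.  The danger is that lexicographic rewriting may raise degrees;
  but a finite Groebner basis involves finitely many monomials, and on finitely many monomials the
  lexicographic order agrees with the order by a positive integral weight, namely the value of the exponent
  vector read as digits in a large base \<open>M\<close>.  Rewriting never raises this weight, and weight and
  degree bound each other up to a constant factor, so the result has degree \<open>O(n)\<close>.  Injectivity
  of \<open>\<phi>\<close> carries the resulting expression back to \<open>A\<close>.

  Groebner bases are replaced by linear algebra: a monomial is \<open>reducible\<close> if its value lies in
  the span of the values of smaller monomials.  These are the leading monomials of the relations,
  and Dickson's lemma provides finitely many of them that divide all others.
\<close>

section \<open>Exponents, Dickson's lemma and weights\<close>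

definition exps :: "nat \<Rightarrow> (nat \<Rightarrow>\<^sub>0 nat) set" where
  "exps r = {k. Poly_Mapping.keys k \<subseteq> {..<r}}"

abbreviation total_deg :: "nat \<Rightarrow> (nat \<Rightarrow>\<^sub>0 nat) \<Rightarrow> nat" where
  "total_deg r k \<equiv> (\<Sum>i<r. Poly_Mapping.lookup k i)"

lemma exps_iff: "k \<in> exps r \<longleftrightarrow> (\<forall>i\<ge>r. Poly_Mapping.lookup k i = 0)"
proof
  show "k \<in> exps r \<Longrightarrow> \<forall>i\<ge>r. Poly_Mapping.lookup k i = 0"
    by (fastforce simp: exps_def in_keys_iff)
  show "\<forall>i\<ge>r. Poly_Mapping.lookup k i = 0 \<Longrightarrow> k \<in> exps r"
    unfolding exps_def by (auto simp: in_keys_iff intro: leI ccontr)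
qed

lemma exps_add: "u \<in> exps r \<Longrightarrow> v \<in> exps r \<Longrightarrow> u + v \<in> exps r"
  by (simp add: exps_iff lookup_add)

lemma exps_eqI:
  assumes "u \<in> exps r" "v \<in> exps r" "\<And>i. i < r \<Longrightarrow> Poly_Mapping.lookup u i = Poly_Mapping.lookup v i"
  shows "u = v"
  using assms by (intro poly_mapping_eqI) (metis exps_iff not_less)

lemma exps_exists: "\<exists>k \<in> exps r. \<forall>i<r. Poly_Mapping.lookup k i = f i"
proof -
  let ?g = "\<lambda>i. if i < r then f i else (0::nat)"
  have "{i. ?g i \<noteq> 0} \<subseteq> {..<r}" by auto
  then have "finite {i. ?g i \<noteq> 0}" using finite_subset by blast
  then have "Poly_Mapping.lookup (Abs_poly_mapping ?g) = ?g" by simp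
  then show ?thesis by (intro bexI[of _ "Abs_poly_mapping ?g"]) (auto simp: exps_iff)
qed

text \<open>
  Dickson's lemma, for a family of exponent vectors.  If the last coordinate of \<open>l\<close> is at least
  that of every member of a finite set \<open>F\<close> that is good for the first \<open>r\<close> coordinates,
  then \<open>F\<close> serves \<open>l\<close>; each of the finitely many smaller values of the last coordinate is
  treated separately.
\<close>

lemma dickson:
  fixes f :: "'x \<Rightarrow> nat \<Rightarrow> nat"
  shows "\<exists>F. finite F \<and> F \<subseteq> L \<and> (\<forall>l\<in>L. \<exists>g\<in>F. \<forall>i<r. f g i \<le> f l i)"
proof (induction r arbitrary: L)
  case 0
  show ?case
  proof (cases "L = {}")
    case False
    then obtain l where "l \<in> L" by blast
    then show ?thesis by (intro exI[of _ "{l}"]) auto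
  qed auto
next
  case (Suc r)
  obtain F where F: "finite F" "F \<subseteq> L" "\<forall>l\<in>L. \<exists>g\<in>F. \<forall>i<r. f g i \<le> f l i"
    using Suc.IH[of L] by (elim exE conjE) (rule that)
  define N where "N = Max ((\<lambda>g. f g r) ` F)"
  have "\<forall>j. \<exists>G. finite G \<and> G \<subseteq> {l\<in>L. f l r = j} \<and>
          (\<forall>l\<in>{l\<in>L. f l r = j}. \<exists>g\<in>G. \<forall>i<r. f g i \<le> f l i)"
    by (intro allI Suc.IH)
  from choice[OF this] obtain G where "\<forall>j. finite (G j) \<and> G j \<subseteq> {l\<in>L. f l r = j} \<and>
          (\<forall>l\<in>{l\<in>L. f l r = j}. \<exists>g\<in>G j. \<forall>i<r. f g i \<le> f l i)" ..
  then have G: "\<And>j. finite (G j)" "\<And>j. G j \<subseteq> {l\<in>L. f l r = j}"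
      "\<And>j. \<forall>l\<in>{l\<in>L. f l r = j}. \<exists>g\<in>G j. \<forall>i<r. f g i \<le> f l i"
    by auto
  show ?case
  proof (intro exI[of _ "F \<union> (\<Union>j<N. G j)"] conjI ballI)
    show "finite (F \<union> (\<Union>j<N. G j))" using F(1) G(1) by auto
    show "F \<union> (\<Union>j<N. G j) \<subseteq> L" using F(2) G(2) by blast
    fix l assume l: "l \<in> L"
    show "\<exists>g\<in>F \<union> (\<Union>j<N. G j). \<forall>i<Suc r. f g i \<le> f l i"
    proof (cases "f l r < N")
      case True
      from l G(3)[of "f l r"] obtain g where g: "g \<in> G (f l r)" "\<forall>i<r. f g i \<le> f l i" by blast
      with G(2) have "f g r = f l r" by blast
      with g True show ?thesis by (intro bexI[of _ g]) (auto simp: less_Suc_eq)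
    next
      case False
      from l F(3) obtain g where g: "g \<in> F" "\<forall>i<r. f g i \<le> f l i" by blast
      have "f g r \<le> N" unfolding N_def using F(1) g(1) by simp
      with False have "f g r \<le> f l r" by simp
      with g show ?thesis by (intro bexI[of _ g]) (auto simp: less_Suc_eq)
    qed
  qed
qed

text \<open>
  The number with digits \<open>u 0, \<dots>, u (r - 1)\<close> in base \<open>M\<close>, the digit \<open>u 0\<close> being the most
  significant one.  It is linear in \<open>u\<close> also when digits exceed \<open>M\<close>.
\<close>

primrec horner :: "nat \<Rightarrow> nat \<Rightarrow> (nat \<Rightarrow> nat) \<Rightarrow> nat" where
  "horner M 0 u = 0"
| "horner M (Suc r) u = M * horner M r u + u r"

lemma horner_add: "horner M r (\<lambda>i. u i + v i) = horner M r u + horner M r v"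
  by (induction r) (auto simp: algebra_simps)

lemma horner_cong: "(\<And>i. i < r \<Longrightarrow> u i = v i) \<Longrightarrow> horner M r u = horner M r v"
  by (induction r) auto

lemma sum_le_horner: "M \<ge> 1 \<Longrightarrow> (\<Sum>i<r. u i) \<le> horner M r u"
proof (induction r)
  case (Suc r)
  then have "(\<Sum>i<r. u i) \<le> 1 * horner M r u" by simp
  also have "\<dots> \<le> M * horner M r u" using Suc.prems by (intro mult_right_mono) auto
  finally show ?case by simp
qed simp

lemma horner_le_sum: "M \<ge> 1 \<Longrightarrow> horner M r u \<le> M ^ r * (\<Sum>i<r. u i)"
proof (induction r)
  case (Suc r)
  have "M * horner M r u \<le> M * (M ^ r * (\<Sum>i<r. u i))" using Suc by simp
  moreover have "1 * u r \<le> M ^ Suc r * u r"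
    using Suc.prems by (intro mult_right_mono) (auto simp del: power_Suc)
  ultimately have "M * horner M r u + 1 * u r \<le> M * (M ^ r * (\<Sum>i<r. u i)) + M ^ Suc r * u r"
    by (rule add_mono)
  then show ?case by (simp add: algebra_simps)
qed simp

text \<open>
  Comparing numbers digit by digit.  Only the digits of the smaller vector have to be below the
  base, because larger digits of \<open>v\<close> can only increase the right-hand side.
\<close>

lemma horner_lex_mono:
  assumes "i0 < r" "u i0 < v i0" "\<forall>j<i0. u j = v j" "\<forall>i<r. u i < M"
  shows "horner M r u < horner M r v"
  using assms
proof (induction r)
  case (Suc r)
  show ?case
  proof (cases "i0 = r")
    case True
    then have "horner M r u = horner M r v" using Suc.prems by (intro horner_cong) auto
    then show ?thesis using True Suc.prems by simp
  next
    case False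
    then have "Suc (horner M r u) \<le> horner M r v" using Suc by simp
    then have "M * Suc (horner M r u) \<le> M * horner M r v" by (rule mult_le_mono2)
    moreover have "u r < M" using Suc.prems by simp
    ultimately show ?thesis by simp
  qed
qed simp

definition weight :: "nat \<Rightarrow> nat \<Rightarrow> (nat \<Rightarrow>\<^sub>0 nat) \<Rightarrow> nat" where
  "weight M r k = horner M r (Poly_Mapping.lookup k)"

lemma weight_add: "weight M r (u + v) = weight M r u + weight M r v"
  unfolding weight_def horner_add[symmetric] by (rule horner_cong) (simp add: lookup_add)

text \<open>
  The library order on finitely supported functions is lexicographic with index \<open>0\<close> most
  significant.
\<close>

lemma lex_lessE:
  fixes u v :: "nat \<Rightarrow>\<^sub>0 nat"
  assumes "u < v"
  obtains i where "Poly_Mapping.lookup u i < Poly_Mapping.lookup v i"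
    "\<And>j. j < i \<Longrightarrow> Poly_Mapping.lookup u j = Poly_Mapping.lookup v j"
  using assms by (auto simp: less_poly_mapping.rep_eq less_fun_def)

lemma weight_lex_mono:
  assumes "u < v" "v \<in> exps r" "\<And>i. i < r \<Longrightarrow> Poly_Mapping.lookup u i < M"
  shows "weight M r u < weight M r v"
proof -
  obtain i where i: "Poly_Mapping.lookup u i < Poly_Mapping.lookup v i"
    "\<And>j. j < i \<Longrightarrow> Poly_Mapping.lookup u j = Poly_Mapping.lookup v j"
    using lex_lessE[OF assms(1)] by blast
  have "i < r" using i(1) assms(2) by (metis exps_iff not_less not_less0)
  then show ?thesis
    unfolding weight_def using i assms(3) by (intro horner_lex_mono) auto
qed

lemma finite_weight_le:
  assumes "M \<ge> 1"
  shows "finite {k \<in> exps r. weight M r k \<le> W}"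
proof (rule finite_imageD)
  have "Poly_Mapping.lookup k i \<le> W" if "weight M r k \<le> W" "i < r" for k i
  proof -
    have "Poly_Mapping.lookup k i \<le> total_deg r k"
      using that(2) by (intro member_le_sum) auto
    also have "\<dots> \<le> weight M r k" unfolding weight_def by (rule sum_le_horner[OF assms])
    finally show ?thesis using that(1) by simp
  qed
  then have "Poly_Mapping.lookup ` {k \<in> exps r. weight M r k \<le> W}
     \<subseteq> {f. \<forall>i. (i \<in> {..<r} \<longrightarrow> f i \<in> {..W}) \<and> (i \<notin> {..<r} \<longrightarrow> f i = 0)}"
    by (auto simp: exps_iff)
  then show "finite (Poly_Mapping.lookup ` {k \<in> exps r. weight M r k \<le> W})"
    by (rule finite_subset) (intro finite_set_of_finite_funs, auto)
  show "inj_on Poly_Mapping.lookup {k \<in> exps r. weight M r k \<le> W}"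
    by (simp add: inj_on_def lookup_inject)
qed

section \<open>Monomials in an algebra\<close>

definition monom_at :: "nat \<Rightarrow> (nat \<Rightarrow> 'b::comm_ring_1) \<Rightarrow> (nat \<Rightarrow>\<^sub>0 nat) \<Rightarrow> 'b" where
  "monom_at r y k = (\<Prod>i<r. y i ^ Poly_Mapping.lookup k i)"

lemma monom_at_add: "monom_at r y (u + v) = monom_at r y u * monom_at r y v"
  by (simp add: monom_at_def lookup_add power_add prod.distrib)

locale field_algebra =
  fixes \<iota> :: "'k::field \<Rightarrow> 'b::comm_ring_1"
  assumes scalar_add: "\<iota> (c + d) = \<iota> c + \<iota> d"
    and scalar_mult: "\<iota> (c * d) = \<iota> c * \<iota> d"
    and scalar_one: "\<iota> 1 = 1"
begin

sublocale vector_space "\<lambda>c b. \<iota> c * b"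
  by unfold_locales (auto simp: scalar_add scalar_mult scalar_one algebra_simps)

definition reducible :: "nat \<Rightarrow> (nat \<Rightarrow> 'b) \<Rightarrow> (nat \<Rightarrow>\<^sub>0 nat) \<Rightarrow> bool" where
  "reducible r y u \<longleftrightarrow> monom_at r y u \<in> span (monom_at r y ` {v \<in> exps r. v < u})"

lemma mult_span: "b \<in> span S \<Longrightarrow> (\<And>s. s \<in> S \<Longrightarrow> a * s \<in> T) \<Longrightarrow> a * b \<in> span T"
proof (induction rule: span_induct_alt)
  case base
  then show ?case by (simp add: span_zero)
next
  case (step c x z)
  have "a * (\<iota> c * x + z) = \<iota> c * (a * x) + a * z" by (simp add: algebra_simps)
  then show ?case using step by (simp add: span_add span_scale span_base)
qed

lemma span_finite_subset:
  assumes "b \<in> span (f ` V)"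
  shows "\<exists>F. finite F \<and> F \<subseteq> V \<and> b \<in> span (f ` F)"
proof -
  from assms obtain t c where t: "finite t" "t \<subseteq> f ` V" "b = (\<Sum>a\<in>t. \<iota> (c a) * a)"
    by (auto simp: span_explicit)
  from finite_subset_image[OF t(1,2)] obtain F where F: "F \<subseteq> V" "finite F" "t = f ` F" by blast
  have "b \<in> span t" unfolding t(3) by (intro span_sum span_scale span_base)
  with F show ?thesis by blast
qed

text \<open>
  Relations can be chosen so as not to raise a suitable weight.  For each of the finitely many
  reducible exponents \<open>g\<close> that generate all reducible ones under addition, fix one relation; a base
  \<open>M\<close> above all exponents in these relations makes each of them lower the weight.  As
  the weight is additive and the order is compatible with addition, so do all their multiples by monomials.
\<close>

lemma reducible_refining_weight:
  "\<exists>M\<ge>1. \<forall>u\<in>exps r. reducible r y u \<longrightarrow>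
     monom_at r y u \<in> span (monom_at r y ` {v \<in> exps r. v < u \<and> weight M r v \<le> weight M r u})"
proof -
  obtain F where F: "finite F" "F \<subseteq> {u \<in> exps r. reducible r y u}"
      "\<forall>u\<in>{u \<in> exps r. reducible r y u}. \<exists>g\<in>F. \<forall>i<r. Poly_Mapping.lookup g i \<le> Poly_Mapping.lookup u i"
    using dickson[of "{u \<in> exps r. reducible r y u}" r Poly_Mapping.lookup] by blast
  have "\<forall>g\<in>F. \<exists>V. finite V \<and> V \<subseteq> {v \<in> exps r. v < g} \<and> monom_at r y g \<in> span (monom_at r y ` V)"
  proof
    fix g assume "g \<in> F"
    then have "monom_at r y g \<in> span (monom_at r y ` {v \<in> exps r. v < g})"
      using F(2) by (auto simp: reducible_def)
    from span_finite_subset[OF this]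
    show "\<exists>V. finite V \<and> V \<subseteq> {v \<in> exps r. v < g} \<and> monom_at r y g \<in> span (monom_at r y ` V)" .
  qed
  from bchoice[OF this] obtain V where
    "\<forall>g\<in>F. finite (V g) \<and> V g \<subseteq> {v \<in> exps r. v < g} \<and> monom_at r y g \<in> span (monom_at r y ` V g)" ..
  then have V: "\<And>g. g \<in> F \<Longrightarrow> finite (V g)" "\<And>g. g \<in> F \<Longrightarrow> V g \<subseteq> {v \<in> exps r. v < g}"
      "\<And>g. g \<in> F \<Longrightarrow> monom_at r y g \<in> span (monom_at r y ` V g)"
    by auto
  let ?E = "(\<lambda>(v, i). Poly_Mapping.lookup v i) ` ((\<Union>g\<in>F. V g) \<times> {..<r})"
  define M where "M = Suc (Max (insert 0 ?E))"
  have "finite (insert 0 ?E)" using F(1) V(1) by auto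
  then have M: "Poly_Mapping.lookup v i < M" if "g \<in> F" "v \<in> V g" "i < r" for g v i
    unfolding M_def less_Suc_eq_le using that by (intro Max_ge) auto
  have "monom_at r y u \<in> span (monom_at r y ` {v \<in> exps r. v < u \<and> weight M r v \<le> weight M r u})"
    if u: "u \<in> exps r" "reducible r y u" for u
  proof -
    obtain g where g: "g \<in> F" "\<forall>i<r. Poly_Mapping.lookup g i \<le> Poly_Mapping.lookup u i" using F(3) u by blast
    have gr: "g \<in> exps r" using g(1) F(2) by blast
    define w where "w = u - g"
    have w: "w \<in> exps r" using u(1) by (simp add: w_def exps_iff lookup_minus)
    have uw: "u = w + g"
      by (rule exps_eqI[OF u(1) exps_add[OF w gr]]) (use g(2) in \<open>simp add: w_def lookup_add lookup_minus\<close>)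
    have "monom_at r y w * monom_at r y g
        \<in> span (monom_at r y ` {v \<in> exps r. v < u \<and> weight M r v \<le> weight M r u})"
    proof (rule mult_span[OF V(3)[OF g(1)]])
      fix s assume "s \<in> monom_at r y ` V g"
      then obtain v where v: "v \<in> V g" "s = monom_at r y v" by blast
      have v': "v \<in> exps r" "v < g" using V(2)[OF g(1)] v(1) by auto
      have "weight M r v < weight M r g"
        using weight_lex_mono[OF v'(2) gr] M[OF g(1) v(1)] by blast
      then have "w + v \<in> {v \<in> exps r. v < u \<and> weight M r v \<le> weight M r u}"
        using v' w exps_add by (simp add: uw weight_add)
      then show "monom_at r y w * s \<in> monom_at r y ` {v \<in> exps r. v < u \<and> weight M r v \<le> weight M r u}"
        unfolding v(2) monom_at_add[symmetric] by blast
    qed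
    then show ?thesis by (simp add: uw monom_at_add)
  qed
  moreover have "M \<ge> 1" by (simp add: M_def)
  ultimately show ?thesis by blast
qed

text \<open>
  Repeated rewriting ends because only finitely many monomials have weight at most \<open>W\<close>.
\<close>

lemma span_irreducible:
  assumes M: "M \<ge> 1"
    and red: "\<And>u. u \<in> exps r \<Longrightarrow> reducible r y u \<Longrightarrow>
      monom_at r y u \<in> span (monom_at r y ` {v \<in> exps r. v < u \<and> weight M r v \<le> weight M r u})"
    and u: "u \<in> exps r" "weight M r u \<le> W"
  shows "monom_at r y u \<in> span (monom_at r y ` {v \<in> exps r. weight M r v \<le> W \<and> \<not> reducible r y v})"
  using u
proof (induction "card {v \<in> exps r. weight M r v \<le> W \<and> v < u}" arbitrary: u rule: less_induct)
  case less
  show ?case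
  proof (cases "reducible r y u")
    case False
    then show ?thesis using less.prems by (intro span_base) auto
  next
    case True
    have "monom_at r y ` {v \<in> exps r. v < u \<and> weight M r v \<le> weight M r u}
       \<subseteq> span (monom_at r y ` {v \<in> exps r. weight M r v \<le> W \<and> \<not> reducible r y v})"
    proof clarify
      fix v assume v: "v \<in> exps r" "v < u" "weight M r v \<le> weight M r u"
      have "{x \<in> exps r. weight M r x \<le> W \<and> x < v} \<subset> {x \<in> exps r. weight M r x \<le> W \<and> x < u}"
      proof
        show "{x \<in> exps r. weight M r x \<le> W \<and> x < v} \<subseteq> {x \<in> exps r. weight M r x \<le> W \<and> x < u}"
          using less_trans[OF _ v(2)] by blast
        have "v \<in> {x \<in> exps r. weight M r x \<le> W \<and> x < u}" "v \<notin> {x \<in> exps r. weight M r x \<le> W \<and> x < v}"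
          using v less.prems by auto
        then show "{x \<in> exps r. weight M r x \<le> W \<and> x < v} \<noteq> {x \<in> exps r. weight M r x \<le> W \<and> x < u}"
          by blast
      qed
      moreover have "finite {x \<in> exps r. weight M r x \<le> W \<and> x < u}"
        by (rule finite_subset[OF _ finite_weight_le[OF M, of r W]]) auto
      ultimately have "card {x \<in> exps r. weight M r x \<le> W \<and> x < v} < card {x \<in> exps r. weight M r x \<le> W \<and> x < u}"
        by (intro psubset_card_mono)
      then show "monom_at r y v \<in> span (monom_at r y ` {v \<in> exps r. weight M r v \<le> W \<and> \<not> reducible r y v})"
        by (rule less.hyps[OF _ v(1)]) (use v(3) less.prems in simp)
    qed
    then have "span (monom_at r y ` {v \<in> exps r. v < u \<and> weight M r v \<le> weight M r u})
       \<subseteq> span (monom_at r y ` {v \<in> exps r. weight M r v \<le> W \<and> \<not> reducible r y v})"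
      by (rule span_minimal) (rule subspace_span)
    then show ?thesis using red[OF less.prems(1) True] by blast
  qed
qed

text \<open>
  This is uniqueness of normal forms.  If the largest element \<open>u\<close> of \<open>U\<close> is outside the initial
  segment \<open>T\<close>, then all of \<open>T\<close> and the rest of \<open>U\<close> lie below \<open>u\<close>; a nonzero coefficient at
  \<open>u\<close> would express its value by smaller monomials.
\<close>

lemma irreducible_span_Int:
  assumes "finite U" "U \<subseteq> exps r" "\<And>u. u \<in> U \<Longrightarrow> \<not> reducible r y u"
    and T: "T \<subseteq> exps r" "\<And>u v. v \<in> T \<Longrightarrow> u \<in> exps r \<Longrightarrow> u < v \<Longrightarrow> u \<in> T"
    and "b \<in> span (monom_at r y ` U)" and bT: "b \<in> span (monom_at r y ` T)"
  shows "b \<in> span (monom_at r y ` (U \<inter> T))"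
  using assms(1,2,3,6)
proof (induction U rule: finite_linorder_max_induct)
  case empty
  then show ?case by simp
next
  case (insert u U)
  show ?case
  proof (cases "u \<in> T")
    case True
    then have "insert u U \<inter> T = insert u U" using insert.hyps insert.prems T(2) by blast
    then show ?thesis using insert.prems by simp
  next
    case False
    from insert.prems(3) obtain c where c: "b - \<iota> c * monom_at r y u \<in> span (monom_at r y ` U)"
      by (auto simp: span_breakdown_eq)
    have "v < u" if "v \<in> T" for v
      using T(2)[OF that, of u] False that insert.prems(1) by (metis insert_subset linorder_neqE)
    then have lower: "U \<subseteq> {v \<in> exps r. v < u}" "T \<subseteq> {v \<in> exps r. v < u}"
      using insert.hyps insert.prems(1) T(1) by auto
    have "c = 0"
    proof (rule ccontr)
      assume "c \<noteq> 0"
      let ?L = "span (monom_at r y ` {v \<in> exps r. v < u})"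
      have "b - \<iota> c * monom_at r y u \<in> ?L" "b \<in> ?L"
        using c bT lower span_mono[OF image_mono] by blast+
      from span_diff[OF this(2) this(1)] have "\<iota> c * monom_at r y u \<in> ?L" by simp
      then have "\<iota> (inverse c) * (\<iota> c * monom_at r y u) \<in> ?L" by (rule span_scale)
      then have "reducible r y u"
        using \<open>c \<noteq> 0\<close> unfolding reducible_def
        by (simp add: mult.assoc[symmetric] scalar_mult[symmetric] scalar_one)
      then show False using insert.prems by blast
    qed
    then have "b \<in> span (monom_at r y ` U)" using c by simp
    then show ?thesis using insert False by simp
  qed
qed

text \<open>
  Effective elimination: an element of the span of an initial segment \<open>T\<close> that has degree at most
  \<open>N\<close> in all variables has degree at most \<open>C * N\<close> within \<open>T\<close>, with \<open>C\<close> independent of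
  the element, \<open>N\<close> and \<open>T\<close>.
\<close>

lemma span_elimination_bound:
  "\<exists>C\<ge>1. \<forall>N T b. T \<subseteq> exps r \<longrightarrow> (\<forall>v\<in>T. \<forall>u\<in>exps r. u < v \<longrightarrow> u \<in> T) \<longrightarrow>
     b \<in> span (monom_at r y ` {k \<in> exps r. total_deg r k \<le> N}) \<longrightarrow>
     b \<in> span (monom_at r y ` T) \<longrightarrow>
     b \<in> span (monom_at r y ` {k \<in> T. total_deg r k \<le> C * N})"
proof -
  obtain M where M: "M \<ge> 1"
    and red: "\<And>u. u \<in> exps r \<Longrightarrow> reducible r y u \<Longrightarrow>
      monom_at r y u \<in> span (monom_at r y ` {v \<in> exps r. v < u \<and> weight M r v \<le> weight M r u})"
    using reducible_refining_weight[of r y] by (elim exE conjE) (rule that, auto)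
  have "b \<in> span (monom_at r y ` {k \<in> T. total_deg r k \<le> M ^ r * N})"
    if T: "T \<subseteq> exps r" "\<And>u v. v \<in> T \<Longrightarrow> u \<in> exps r \<Longrightarrow> u < v \<Longrightarrow> u \<in> T"
      and b: "b \<in> span (monom_at r y ` {k \<in> exps r. total_deg r k \<le> N})"
      and bT: "b \<in> span (monom_at r y ` T)" for N T b
  proof -
    let ?U = "{v \<in> exps r. weight M r v \<le> M ^ r * N \<and> \<not> reducible r y v}"
    have "weight M r k \<le> M ^ r * N" if "total_deg r k \<le> N" for k
      unfolding weight_def using horner_le_sum[OF M, of r] that
      by (meson le_trans mult_le_mono2)
    then have "monom_at r y ` {k \<in> exps r. total_deg r k \<le> N} \<subseteq> span (monom_at r y ` ?U)"
      by (intro image_subsetI span_irreducible[OF M red]) auto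
    then have "b \<in> span (monom_at r y ` ?U)"
      by (rule subsetD[OF span_minimal[OF _ subspace_span] b])
    moreover have "finite ?U"
      by (rule finite_subset[OF _ finite_weight_le[OF M, of r "M ^ r * N"]]) auto
    ultimately have "b \<in> span (monom_at r y ` (?U \<inter> T))"
      using T bT by (intro irreducible_span_Int) auto
    moreover have "?U \<inter> T \<subseteq> {k \<in> T. total_deg r k \<le> M ^ r * N}"
      using sum_le_horner[OF M, of _ r] unfolding weight_def by (auto intro: le_trans)
    ultimately show ?thesis by (rule rev_subsetD[OF _ span_mono[OF image_mono]])
  qed
  moreover have "M ^ r \<ge> 1" using M by simp
  ultimately show ?thesis by (intro exI[of _ "M ^ r"] conjI allI impI) blast+
qed

end

section \<open>Admissible pseudovaluations and spans of monomials\<close>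

lemma proper_pv_mult:
  assumes "proper_pseudovaluation \<nu>" "- ereal x \<le> \<nu> a" "- ereal z \<le> \<nu> b"
  shows "- ereal (x + z) \<le> \<nu> (a * b)"
proof -
  have "- ereal (x + z) = - ereal x + - ereal z" by simp
  also have "\<dots> \<le> \<nu> a + \<nu> b" by (rule add_mono[OF assms(2,3)])
  also have "\<dots> \<le> \<nu> (a * b)"
    using assms(1) by (simp add: proper_pseudovaluation_def pseudovaluation_def)
  finally show ?thesis .
qed

lemma proper_pv_power:
  assumes "proper_pseudovaluation \<nu>" "- ereal e \<le> \<nu> a"
  shows "- ereal (e * real n) \<le> \<nu> (a ^ n)"
proof (induction n)
  case 0
  then show ?case using assms(1) by (simp add: proper_pseudovaluation_def pseudovaluation_def)
next
  case (Suc n)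
  from proper_pv_mult[OF assms(1) assms(2) Suc] show ?case by (simp add: algebra_simps)
qed

lemma proper_pv_monom:
  assumes "proper_pseudovaluation \<nu>" "\<And>i. i < r \<Longrightarrow> - ereal e \<le> \<nu> (y i)"
  shows "- ereal (e * real (total_deg r k)) \<le> \<nu> (monom_at r y k)"
  using assms(2)
proof (induction r)
  case 0
  then show ?case
    using assms(1) by (simp add: proper_pseudovaluation_def pseudovaluation_def monom_at_def)
next
  case (Suc r)
  have "- ereal (e * real (total_deg r k) + e * real (Poly_Mapping.lookup k r))
      \<le> \<nu> (monom_at r y k * y r ^ Poly_Mapping.lookup k r)"
    using Suc by (intro proper_pv_mult[OF assms(1)] proper_pv_power[OF assms(1)]) auto
  then show ?case by (simp add: monom_at_def algebra_simps)
qed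

text \<open>
  The induction carries an arbitrary further scalar \<open>c\<close>: a scalar may cost up to \<open>d\<close>, and in this
  form the cost is paid once and not once for each scalar multiplication in the span.
\<close>

lemma (in field_algebra) proper_pv_span:
  assumes \<nu>: "proper_pseudovaluation \<nu>"
    and y: "\<And>i. i < r \<Longrightarrow> - ereal e \<le> \<nu> (y i)"
    and scal: "\<And>c. - ereal d \<le> \<nu> (\<iota> c)"
    and V: "\<And>k. k \<in> V \<Longrightarrow> e * real (total_deg r k) \<le> N"
    and b: "b \<in> span (monom_at r y ` V)"
  shows "- ereal (d + N) \<le> \<nu> b"
proof -
  have "\<forall>c. - ereal (d + N) \<le> \<nu> (\<iota> c * b)"
    using b
  proof (induction rule: span_induct_alt)
    case base
    then show ?case using \<nu> by (simp add: proper_pseudovaluation_def pseudovaluation_def)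
  next
    case (step c x z)
    show ?case
    proof
      fix c'
      from step(1) obtain k where k: "k \<in> V" "x = monom_at r y k" by blast
      have "- ereal (d + e * real (total_deg r k)) \<le> \<nu> (\<iota> (c' * c) * monom_at r y k)"
        by (intro proper_pv_mult[OF \<nu>] scal proper_pv_monom[OF \<nu>] y)
      moreover have "- ereal (d + N) \<le> - ereal (d + e * real (total_deg r k))"
        using V[OF k(1)] by simp
      ultimately have "- ereal (d + N) \<le> \<nu> (\<iota> (c' * c) * x)" unfolding k(2) by (rule order_trans[rotated])
      moreover have "- ereal (d + N) \<le> \<nu> (\<iota> c' * z)" using step by blast
      ultimately have "- ereal (d + N) \<le> min (\<nu> (\<iota> (c' * c) * x)) (\<nu> (\<iota> c' * z))" by simp
      also have "\<dots> \<le> \<nu> (\<iota> (c' * c) * x + \<iota> c' * z)"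
        using \<nu> unfolding proper_pseudovaluation_def pseudovaluation_def by blast
      finally show "- ereal (d + N) \<le> \<nu> (\<iota> c' * (\<iota> c * x + z))"
        by (simp add: scalar_mult algebra_simps)
    qed
  qed
  from spec[OF this, of 1] show ?thesis by (simp add: scalar_one)
qed

lemma ereal_affine_mono:
  assumes "0 < c" "- ereal x \<le> v"
  shows "- ereal (c * x + d) \<le> ereal c * v - ereal d"
proof (cases v)
  case (real w)
  then have "c * (- x) \<le> c * w" using assms by (intro mult_left_mono) auto
  then show ?thesis using real by simp
qed (use assms in auto)

lemma carrier_mpoly_ring: "carrier (mpoly_ring m) = {f. Poly_Mapping.keys f \<subseteq> exps m}"
  by (auto simp: mpoly_ring_def exps_def)

text \<open>
  A homomorphism on the polynomial ring is evaluation at the images of the variables.  As \<open>\<pi>\<close> is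
  controlled on the carrier only, every intermediate polynomial has to be kept in the first
  \<open>m\<close> variables.
\<close>

lemma poly_surjection_expand:
  assumes \<pi>: "poly_surjection \<iota> m \<pi>" and f: "Poly_Mapping.keys f \<subseteq> exps m"
  shows "\<pi> f = (\<Sum>k\<in>Poly_Mapping.keys f. \<iota> (Poly_Mapping.lookup f k) *
            monom_at m (\<lambda>i. \<pi> (Poly_Mapping.single (Poly_Mapping.single i 1) 1)) k)"
proof -
  let ?y = "\<lambda>i. \<pi> (Poly_Mapping.single (Poly_Mapping.single i 1) 1)"
  have hom: "\<pi> \<in> ring_hom (mpoly_ring m) ring_of_type_algebra"
    and const: "\<And>c. \<pi> (Poly_Mapping.single 0 c) = \<iota> c"
    using \<pi> by (auto simp: poly_surjection_def)
  have add: "\<pi> (g + h) = \<pi> g + \<pi> h" and mult: "\<pi> (g * h) = \<pi> g * \<pi> h"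
    if "Poly_Mapping.keys g \<subseteq> exps m" "Poly_Mapping.keys h \<subseteq> exps m" for g h
    using ring_hom_add[OF hom, of g h] ring_hom_mult[OF hom, of g h] that
    unfolding carrier_mpoly_ring by (simp_all add: mpoly_ring_def ring_of_type_algebra_def)
  have one: "\<pi> 1 = 1"
    using ring_hom_one[OF hom] by (simp add: mpoly_ring_def ring_of_type_algebra_def)
  have zero: "\<pi> 0 = 0" using add[of 0 0] by simp
  have sing: "Poly_Mapping.keys (Poly_Mapping.single k c) \<subseteq> exps m" if "k \<in> exps m" for k and c :: 'a
    using that by simp
  have exps_single: "Poly_Mapping.single i n \<in> exps m" if "i < m" for i n
    using that by (auto simp: exps_iff lookup_single when_def)
  have exps_zero: "0 \<in> exps m" by (simp add: exps_iff)
  have single_power: "\<pi> (Poly_Mapping.single (Poly_Mapping.single i n) 1) = ?y i ^ n" if "i < m" for i n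
  proof (induction n)
    case 0
    then show ?case using one by simp
  next
    case (Suc n)
    have "Poly_Mapping.single (Poly_Mapping.single i (Suc n)) (1::'a) =
        Poly_Mapping.single (Poly_Mapping.single i 1) 1 * Poly_Mapping.single (Poly_Mapping.single i n) 1"
      by (simp add: mult_single single_add[symmetric])
    then show ?case using Suc mult sing exps_single[OF that] by simp
  qed
  have single_prod: "\<pi> (Poly_Mapping.single (\<Sum>i<j. Poly_Mapping.single i (n i)) 1) = (\<Prod>i<j. ?y i ^ n i)"
    and exps_sum: "(\<Sum>i<j. Poly_Mapping.single i (n i)) \<in> exps m"
    if "j \<le> m" for j n
  proof -
    have "(\<Sum>i<j. Poly_Mapping.single i (n i)) \<in> exps m \<and>
      \<pi> (Poly_Mapping.single (\<Sum>i<j. Poly_Mapping.single i (n i)) 1) = (\<Prod>i<j. ?y i ^ n i)"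
      using that
    proof (induction j)
      case 0
      then show ?case using one exps_zero by simp
    next
      case (Suc j)
      have "Poly_Mapping.single (\<Sum>i<Suc j. Poly_Mapping.single i (n i)) (1::'a) =
        Poly_Mapping.single (\<Sum>i<j. Poly_Mapping.single i (n i)) 1 * Poly_Mapping.single (Poly_Mapping.single j (n j)) 1"
        by (simp add: mult_single)
      then show ?case
        using Suc mult[OF sing sing] exps_single[of j "n j"] single_power[of j "n j"] exps_add by simp
    qed
    then show "\<pi> (Poly_Mapping.single (\<Sum>i<j. Poly_Mapping.single i (n i)) 1) = (\<Prod>i<j. ?y i ^ n i)"
      "(\<Sum>i<j. Poly_Mapping.single i (n i)) \<in> exps m" by auto
  qed
  have monom: "\<pi> (Poly_Mapping.single k c) = \<iota> c * monom_at m ?y k" if k: "k \<in> exps m" for k c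
  proof -
    have "k = (\<Sum>i<m. Poly_Mapping.single i (Poly_Mapping.lookup k i))"
      by (rule exps_eqI[OF k exps_sum]) (auto simp: lookup_sum lookup_single when_def)
    then have "\<pi> (Poly_Mapping.single k 1) = monom_at m ?y k"
      using single_prod[of m "Poly_Mapping.lookup k"] by (simp add: monom_at_def)
    moreover have "Poly_Mapping.single k c = Poly_Mapping.single 0 c * Poly_Mapping.single k 1"
      by (simp add: mult_single)
    ultimately show ?thesis using mult[OF sing sing] exps_zero k const by simp
  qed
  have sum: "\<pi> (\<Sum>k\<in>S. Poly_Mapping.single k (g k)) = (\<Sum>k\<in>S. \<iota> (g k) * monom_at m ?y k)"
    if "finite S" "S \<subseteq> exps m" for S g
    using that
  proof (induction S rule: finite_induct)
    case empty
    then show ?case using zero by simp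
  next
    case (insert k S)
    have "Poly_Mapping.keys (\<Sum>k\<in>S. Poly_Mapping.single k (g k)) \<subseteq> exps m"
      using insert.prems by (intro order_trans[OF keys_sum]) auto
    then show ?case using insert add[OF sing] monom by simp
  qed
  have "f = (\<Sum>k\<in>Poly_Mapping.keys f. Poly_Mapping.single k (Poly_Mapping.lookup f k))"
    by (rule poly_mapping_eqI) (auto simp: lookup_sum lookup_single when_def in_keys_iff)
  then show ?thesis using sum[OF finite_keys f, of "Poly_Mapping.lookup f"] by simp
qed

lemma field_algebra_of_fg:
  fixes \<iota> :: "'k::field \<Rightarrow> 'a::comm_ring_1"
  assumes "fg_algebra \<iota>"
  shows "field_algebra \<iota>"
proof -
  have hom: "\<iota> \<in> ring_hom ring_of_type_algebra ring_of_type_algebra"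
    using assms by (simp add: fg_algebra_def)
  show ?thesis
    using ring_hom_add[OF hom] ring_hom_mult[OF hom] ring_hom_one[OF hom]
    by unfold_locales (auto simp: ring_of_type_algebra_def)
qed

lemma quotient_pv_span:
  fixes \<iota> :: "'k::field \<Rightarrow> 'a::comm_ring_1"
  assumes "field_algebra \<iota>" "poly_surjection \<iota> m \<pi>" "- ereal n < quotient_pv m d \<pi> a"
  shows "a \<in> module.span (\<lambda>c b. \<iota> c * b)
     (monom_at m (\<lambda>i. \<pi> (Poly_Mapping.single (Poly_Mapping.single i 1) 1))
       ` {k \<in> exps m. (\<Sum>i<m. real (Poly_Mapping.lookup k i) * d i) \<le> n})"
proof -
  interpret field_algebra \<iota> by fact
  from assms(3) obtain f where f: "Poly_Mapping.keys f \<subseteq> exps m" "\<pi> f = a"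
      and less: "- ereal n < weighted_degree_pv m d f"
    by (auto simp: quotient_pv_def less_SUP_iff carrier_mpoly_ring)
  have deg: "(\<Sum>i<m. real (Poly_Mapping.lookup k i) * d i) \<le> n" if "k \<in> Poly_Mapping.keys f" for k
  proof -
    have "weighted_degree_pv m d f \<le> trivial_valuation (Poly_Mapping.lookup f k)
               - ereal (\<Sum>i<m. real (Poly_Mapping.lookup k i) * d i)"
      unfolding weighted_degree_pv_def by (rule INF_lower) simp
    also have "\<dots> = - ereal (\<Sum>i<m. real (Poly_Mapping.lookup k i) * d i)"
      using that by (simp add: trivial_valuation_def in_keys_iff zero_ereal_def)
    finally have "- ereal n < - ereal (\<Sum>i<m. real (Poly_Mapping.lookup k i) * d i)"
      using less by (rule less_le_trans[rotated])
    then show ?thesis by simp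
  qed
  show ?thesis
    unfolding f(2)[symmetric] poly_surjection_expand[OF assms(2) f(1)]
    using deg f(1) by (intro span_sum span_scale span_base) auto
qed

lemma admissibleE:
  assumes "admissible \<iota> \<nu>"
  obtains m \<pi> d c1 c2 d1 d2 where "poly_surjection \<iota> m \<pi>" "\<And>i. i < m \<Longrightarrow> d i > 0"
    "c1 > 0" "c2 > 0" "d1 \<ge> 0" "d2 \<ge> 0"
    "\<And>a. ereal c2 * quotient_pv m d \<pi> a - ereal d2 \<le> \<nu> a"
    "\<And>a. ereal c1 * \<nu> a - ereal d1 \<le> quotient_pv m d \<pi> a"
proof -
  have "\<exists>m \<pi> d. poly_surjection \<iota> m \<pi> \<and> (\<forall>i<m. d i > 0) \<and>
      linearly_equivalent \<nu> (quotient_pv m d \<pi>)"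
    using assms by (simp add: admissible_def)
  then obtain m \<pi> d where m: "poly_surjection \<iota> m \<pi> \<and> (\<forall>i<m. d i > 0) \<and>
      linearly_equivalent \<nu> (quotient_pv m d \<pi>)"
    by (elim exE) (rule that)
  then have "linearly_equivalent \<nu> (quotient_pv m d \<pi>)" by simp
  then obtain c1 c2 d1 d2 where "c1 > 0 \<and> c2 > 0 \<and> d1 \<ge> 0 \<and> d2 \<ge> 0 \<and>
      (\<forall>a. \<nu> a \<ge> ereal c2 * quotient_pv m d \<pi> a - ereal d2 \<and>
           quotient_pv m d \<pi> a \<ge> ereal c1 * \<nu> a - ereal d1)"
    unfolding linearly_equivalent_def by (elim exE) (rule that)
  with m show ?thesis by (intro that[of m \<pi> d c1 c2 d1 d2]) simp_all
qed

text \<open>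
  The first of the two consequences of admissibility used below: a lower bound on \<open>\<nu>\<close> is a degree
  bound.  Positive variable weights are compared with the degree through their minimum.
\<close>

lemma admissible_generators:
  fixes \<iota> :: "'k::field \<Rightarrow> 'a::comm_ring_1"
  assumes "field_algebra \<iota>" "admissible \<iota> \<nu>"
  shows "\<exists>m y C D. C > 0 \<and> D \<ge> 0 \<and> (\<forall>a x. - ereal x \<le> \<nu> a \<longrightarrow>
     a \<in> module.span (\<lambda>c b. \<iota> c * b) (monom_at m y ` {k \<in> exps m. real (total_deg m k) \<le> C * x + D}))"
proof -
  interpret field_algebra \<iota> by fact
  obtain m \<pi> d c1 d1 where \<pi>: "poly_surjection \<iota> m \<pi>" and d: "\<And>i. i < m \<Longrightarrow> d i > 0"
    and c1: "c1 > 0" "d1 \<ge> 0" "\<And>a. ereal c1 * \<nu> a - ereal d1 \<le> quotient_pv m d \<pi> a"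
    using assms(2) by (rule admissibleE) (rule that; assumption)
  \<comment> \<open>The element 1 keeps the set nonempty when \<open>m = 0\<close>.\<close>
  define \<delta> where "\<delta> = Min (insert 1 (d ` {..<m}))"
  have \<delta>: "\<delta> > 0" "\<And>i. i < m \<Longrightarrow> \<delta> \<le> d i"
    unfolding \<delta>_def using d by auto
  let ?y = "\<lambda>i. \<pi> (Poly_Mapping.single (Poly_Mapping.single i 1) 1)"
  have "a \<in> span (monom_at m ?y ` {k \<in> exps m. real (total_deg m k) \<le> c1 / \<delta> * x + (d1 + 1) / \<delta>})"
    if x: "- ereal x \<le> \<nu> a" for a x
  proof -
    \<comment> \<open>The summand 1 makes the bound strict; the supremum in \<^const>\<open>quotient_pv\<close> need not be attained.\<close>
    have "- ereal (c1 * x + (d1 + 1)) < - ereal (c1 * x + d1)" by simp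
    also have "\<dots> \<le> ereal c1 * \<nu> a - ereal d1" by (rule ereal_affine_mono[OF c1(1) x])
    also have "\<dots> \<le> quotient_pv m d \<pi> a" by (rule c1(3))
    finally have "a \<in> span (monom_at m ?y ` {k \<in> exps m. (\<Sum>i<m. real (Poly_Mapping.lookup k i) * d i)
        \<le> c1 * x + (d1 + 1)})"
      by (rule quotient_pv_span[OF assms(1) \<pi>])
    moreover have "real (total_deg m k) \<le> c1 / \<delta> * x + (d1 + 1) / \<delta>"
      if "(\<Sum>i<m. real (Poly_Mapping.lookup k i) * d i) \<le> c1 * x + (d1 + 1)" for k
    proof -
      have "real (total_deg m k) * \<delta> = (\<Sum>i<m. real (Poly_Mapping.lookup k i) * \<delta>)"
        by (simp add: sum_distrib_right)
      also have "\<dots> \<le> (\<Sum>i<m. real (Poly_Mapping.lookup k i) * d i)"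
        using \<delta>(2) by (intro sum_mono mult_left_mono) auto
      finally show ?thesis using that \<delta>(1) by (simp add: field_simps)
    qed
    then have "{k \<in> exps m. (\<Sum>i<m. real (Poly_Mapping.lookup k i) * d i) \<le> c1 * x + (d1 + 1)}
       \<subseteq> {k \<in> exps m. real (total_deg m k) \<le> c1 / \<delta> * x + (d1 + 1) / \<delta>}" by blast
    ultimately show ?thesis by (rule rev_subsetD[OF _ span_mono[OF image_mono]])
  qed
  moreover have "c1 / \<delta> > 0" "(d1 + 1) / \<delta> \<ge> 0" using c1 \<delta>(1) by auto
  ultimately show ?thesis
    by (intro exI[of _ m] exI[of _ ?y] exI[of _ "c1 / \<delta>"] exI[of _ "(d1 + 1) / \<delta>"] conjI allI impI)
qed

text \<open>
  An admissible pseudovaluation need not vanish on nonzero scalars, but the quotient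
  pseudovaluation is nonnegative there, since constants have degree zero.
\<close>

lemma admissible_scalar_bound:
  fixes \<iota> :: "'k::field \<Rightarrow> 'a::comm_ring_1"
  assumes "admissible \<iota> \<nu>"
  shows "\<exists>d\<ge>0. \<forall>c. - ereal d \<le> \<nu> (\<iota> c)"
proof -
  obtain m \<pi> d c2 d2 where \<pi>: "poly_surjection \<iota> m \<pi>"
    and c2: "c2 > 0" "d2 \<ge> 0" "\<And>a. ereal c2 * quotient_pv m d \<pi> a - ereal d2 \<le> \<nu> a"
    using assms by (rule admissibleE) (rule that; assumption)
  have "- ereal d2 \<le> \<nu> (\<iota> c)" for c
  proof -
    let ?f = "Poly_Mapping.single 0 c :: 'k mpoly"
    have "0 \<le> weighted_degree_pv m d ?f"
      unfolding weighted_degree_pv_def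
      by (intro INF_greatest) (auto simp: trivial_valuation_def lookup_single when_def)
    also have "\<dots> \<le> quotient_pv m d \<pi> (\<iota> c)"
      unfolding quotient_pv_def using \<pi>
      by (intro SUP_upper) (auto simp: carrier_mpoly_ring exps_iff poly_surjection_def split: if_splits)
    finally have "- ereal 0 \<le> quotient_pv m d \<pi> (\<iota> c)" by (simp add: zero_ereal_def)
    from ereal_affine_mono[OF c2(1) this, of d2]
    have "- ereal d2 \<le> ereal c2 * quotient_pv m d \<pi> (\<iota> c) - ereal d2" by simp
    also have "\<dots> \<le> \<nu> (\<iota> c)" by (rule c2(3))
    finally show ?thesis .
  qed
  with c2(2) show ?thesis by blast
qed

text \<open>
  The second consequence: conversely, a degree bound is a lower bound on \<open>\<nu>\<close>, here for arbitrary
  elements \<open>y\<close> in place of generators.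
\<close>

lemma admissible_span_bound:
  fixes \<iota> :: "'k::field \<Rightarrow> 'a::comm_ring_1"
  assumes "field_algebra \<iota>" "admissible \<iota> \<nu>"
  shows "\<exists>d e. d \<ge> 0 \<and> e > 0 \<and> (\<forall>N b.
     b \<in> module.span (\<lambda>c b. \<iota> c * b) (monom_at r y ` {k. real (total_deg r k) \<le> N}) \<longrightarrow>
     - ereal (d + e * N) \<le> \<nu> b)"
proof -
  interpret field_algebra \<iota> by fact
  obtain d where d: "d \<ge> 0" "\<And>c. - ereal d \<le> \<nu> (\<iota> c)"
    using admissible_scalar_bound[OF assms(2)] by blast
  have \<nu>: "proper_pseudovaluation \<nu>"
    using assms(2) by (simp add: admissible_def negative_pseudovaluation_def)
  have "\<exists>e. - ereal e \<le> \<nu> a" for a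
  proof (cases "\<nu> a")
    case (real w)
    then show ?thesis by (intro exI[of _ "- w"]) simp
  next
    case MInf
    then show ?thesis using \<nu> by (simp add: proper_pseudovaluation_def)
  qed auto
  then have "\<forall>a. \<exists>e. - ereal e \<le> \<nu> a" by blast
  from choice[OF this] obtain g where "\<forall>a. - ereal (g a) \<le> \<nu> a" ..
  then have g: "- ereal (g a) \<le> \<nu> a" for a by blast
  define e where "e = Max (insert 1 ((\<lambda>i. g (y i)) ` {..<r}))"
  have e: "1 \<le> e" "\<And>i. i < r \<Longrightarrow> g (y i) \<le> e" unfolding e_def by auto
  have "- ereal e \<le> \<nu> (y i)" if "i < r" for i
    using order_trans[OF _ g, of "- ereal e" "y i"] e(2)[OF that] by simp
  then have "- ereal (d + e * N) \<le> \<nu> b"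
    if "b \<in> span (monom_at r y ` {k. real (total_deg r k) \<le> N})" for N b
    using that e(1) by (intro proper_pv_span[OF \<nu> _ d(2)]) (auto intro: mult_left_mono)
  moreover have "e > 0" using e(1) by simp
  ultimately show ?thesis using d(1) by (intro exI[of _ d] exI[of _ e] conjI allI impI)
qed

section \<open>Linear comparison along homomorphisms\<close>

definition linearly_bounded_below :: "('a \<Rightarrow> ereal) \<Rightarrow> ('a \<Rightarrow> ereal) \<Rightarrow> bool" where
  "linearly_bounded_below \<nu> \<mu> \<longleftrightarrow>
     (\<exists>C>0. \<exists>D\<ge>0. \<forall>a x. 0 \<le> x \<longrightarrow> - ereal x \<le> \<mu> a \<longrightarrow> - ereal (C * x + D) \<le> \<nu> a)"

text \<open>
  A multiplicative constant \<open>C\<close> is absorbed by dividing the radius by it, and an additive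
  constant only shifts the infimum because it is divided by \<open>p\<^sup>i \<ge> 1\<close>.
\<close>

lemma overconvergent_witt_mono:
  assumes "linearly_bounded_below \<nu> \<mu>" "p > 0" "\<alpha> \<in> overconvergent_witt p \<mu>"
  shows "\<alpha> \<in> overconvergent_witt p \<nu>"
proof -
  from assms(3) obtain \<epsilon> where \<epsilon>: "\<epsilon> > 0" "gauss_norm p \<mu> \<epsilon> \<alpha> \<noteq> - \<infinity>"
    by (auto simp: overconvergent_witt_def witt_radius_def)
  have "\<exists>G\<ge>0. - ereal G \<le> gauss_norm p \<mu> \<epsilon> \<alpha>"
  proof (cases "gauss_norm p \<mu> \<epsilon> \<alpha>")
    case (real w)
    then show ?thesis by (intro exI[of _ "max 0 (- w)"]) (auto simp del: ereal_max simp: max_def)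
  qed (use \<epsilon> in auto)
  then obtain G where G: "G \<ge> 0" "- ereal G \<le> gauss_norm p \<mu> \<epsilon> \<alpha>" by blast
  from assms(1) obtain C D where C: "C > 0" "D \<ge> 0"
    and CD: "\<And>a x. 0 \<le> x \<Longrightarrow> - ereal x \<le> \<mu> a \<Longrightarrow> - ereal (C * x + D) \<le> \<nu> a"
    unfolding linearly_bounded_below_def by blast
  define \<eta> where "\<eta> = \<epsilon> / C"
  have \<eta>: "\<eta> > 0" using \<epsilon> C by (simp add: \<eta>_def)
  have "- ereal (G + \<eta> * D) \<le> ereal (real i) + ereal (\<eta> / real p ^ i) * \<nu> (\<alpha> i)" for i
  proof -
    define q where "q = real p ^ i"
    have q: "q \<ge> 1" using assms(2) by (simp add: q_def)
    define x where "x = q / \<epsilon> * (G + real i)"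
    have x: "x \<ge> 0" using q \<epsilon> G by (simp add: x_def)
    have \<mu>i: "- ereal G \<le> ereal (real i) + ereal (\<epsilon> / q) * \<mu> (\<alpha> i)"
      using G(2) unfolding gauss_norm_def q_def by (rule order_trans) (rule INF_lower, simp)
    have "- ereal x \<le> \<mu> (\<alpha> i)"
    proof (cases "\<mu> (\<alpha> i)")
      case (real w)
      with \<mu>i have "- (\<epsilon> / q * w) \<le> G + real i" by simp
      then have "q / \<epsilon> * - (\<epsilon> / q * w) \<le> x"
        unfolding x_def using q \<epsilon> by (intro mult_left_mono) auto
      moreover have "q / \<epsilon> * - (\<epsilon> / q * w) = - w" using q \<epsilon> by simp
      ultimately show ?thesis using real by simp
    next
      case MInf
      with \<mu>i \<epsilon> q show ?thesis by simp
    qed simp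
    then have *: "- ereal (C * x + D) \<le> \<nu> (\<alpha> i)" by (rule CD[OF x])
    have "\<eta> / q * (C * x + D) = G + real i + \<eta> * D / q"
      using q \<epsilon> C by (simp add: \<eta>_def x_def distrib_left)
    moreover have "\<eta> * D / q \<le> \<eta> * D / 1"
      using q \<eta> C by (intro divide_left_mono) auto
    ultimately have "- (G + \<eta> * D) \<le> real i - \<eta> / q * (C * x + D)" by simp
    then have "- ereal (G + \<eta> * D) \<le> ereal (real i) + - ereal (\<eta> / q * (C * x + D))" by simp
    also have "- ereal (\<eta> / q * (C * x + D)) \<le> ereal (\<eta> / q) * \<nu> (\<alpha> i)"
      using ereal_affine_mono[OF _ *, of "\<eta> / q" 0] \<eta> q by simp
    finally show ?thesis by (simp add: q_def add_left_mono)
  qed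
  then have "- ereal (G + \<eta> * D) \<le> gauss_norm p \<nu> \<eta> \<alpha>"
    unfolding gauss_norm_def by (intro INF_greatest)
  then have "gauss_norm p \<nu> \<eta> \<alpha> \<noteq> - \<infinity>" by auto
  with \<eta> show ?thesis by (auto simp: overconvergent_witt_def witt_radius_def)
qed

locale algebra_hom = A: field_algebra \<iota>A + B: field_algebra \<iota>B
  for \<iota>A :: "'k::field \<Rightarrow> 'a::comm_ring_1" and \<iota>B :: "'k \<Rightarrow> 'b::comm_ring_1" +
  fixes \<phi> :: "'a \<Rightarrow> 'b"
  assumes hom_add: "\<phi> (a + a') = \<phi> a + \<phi> a'"
    and hom_mult: "\<phi> (a * a') = \<phi> a * \<phi> a'"
    and hom_one: "\<phi> 1 = 1"
    and hom_scalar: "\<phi> (\<iota>A c) = \<iota>B c"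
begin

sublocale linear: Vector_Spaces.linear "\<lambda>c a. \<iota>A c * a" "\<lambda>c b. \<iota>B c * b" \<phi>
  by unfold_locales (auto simp: hom_add hom_mult hom_scalar)

lemma hom_monom_at: "\<phi> (monom_at r t k) = monom_at r (\<lambda>i. \<phi> (t i)) k"
proof -
  have "\<phi> (a ^ n) = \<phi> a ^ n" for a n by (induction n) (auto simp: hom_one hom_mult)
  then show ?thesis unfolding monom_at_def by (induction r) (auto simp: hom_one hom_mult)
qed

text \<open>
  Substitution: a polynomial in the generators of \<open>A\<close> is mapped to the same polynomial in their
  images, on which \<open>\<nu>B\<close> is bounded below because it never takes the value \<open>-\<infinity>\<close>.
\<close>

lemma admissible_pullback_bounded_below:
  assumes "admissible \<iota>A \<nu>A" "admissible \<iota>B \<nu>B"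
  shows "linearly_bounded_below (\<lambda>a. \<nu>B (\<phi> a)) \<nu>A"
proof -
  obtain m t C D where CD: "C > 0 \<and> D \<ge> 0 \<and> (\<forall>a x. - ereal x \<le> \<nu>A a \<longrightarrow>
      a \<in> A.span (monom_at m t ` {k \<in> exps m. real (total_deg m k) \<le> C * x + D}))"
    using admissible_generators[OF A.field_algebra_axioms assms(1)] by (elim exE) (rule that)
  then have C: "C > 0" "D \<ge> 0" by simp_all
  from CD have gen: "a \<in> A.span (monom_at m t ` {k \<in> exps m. real (total_deg m k) \<le> C * x + D})"
    if "- ereal x \<le> \<nu>A a" for a x
    using that by simp
  obtain d e where de: "d \<ge> 0 \<and> e > 0 \<and> (\<forall>N b.
      b \<in> B.span (monom_at m (\<lambda>i. \<phi> (t i)) ` {k. real (total_deg m k) \<le> N}) \<longrightarrow>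
      - ereal (d + e * N) \<le> \<nu>B b)"
    using admissible_span_bound[OF B.field_algebra_axioms assms(2), of m "\<lambda>i. \<phi> (t i)"]
    by (elim exE) (rule that)
  then have d: "d \<ge> 0" "e > 0" by simp_all
  from de have bound: "- ereal (d + e * N) \<le> \<nu>B b"
    if "b \<in> B.span (monom_at m (\<lambda>i. \<phi> (t i)) ` {k. real (total_deg m k) \<le> N})" for N b
    using that by simp
  have "- ereal (e * C * x + (d + e * D)) \<le> \<nu>B (\<phi> a)" if "- ereal x \<le> \<nu>A a" for a x
  proof -
    have "\<phi> a \<in> B.span (\<phi> ` monom_at m t ` {k \<in> exps m. real (total_deg m k) \<le> C * x + D})"
      using gen[OF that] unfolding linear.span_image by blast
    also have "\<dots> \<subseteq> B.span (monom_at m (\<lambda>i. \<phi> (t i)) ` {k. real (total_deg m k) \<le> C * x + D})"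
      by (intro B.span_mono) (auto simp: hom_monom_at)
    finally show ?thesis using bound by (fastforce simp: algebra_simps)
  qed
  then show ?thesis
    unfolding linearly_bounded_below_def using C d
    by (intro exI[of _ "e * C"] exI[of _ "d + e * D"] conjI) auto
qed

text \<open>
  Elimination with the variables \<open>z\<close>: first the generators \<open>y\<close> of \<open>B\<close>, then the images of the
  generators \<open>t\<close> of \<open>A\<close>.  The exponents in which no \<open>y\<close> occurs form an initial segment \<open>T\<close>, since
  the \<open>y\<close> come first in the lexicographic order, and the image of \<open>\<phi>\<close> is the span of \<open>T\<close>.
\<close>

lemma admissible_descent_bounded_below:
  assumes "inj \<phi>" "admissible \<iota>A \<nu>A" "admissible \<iota>B \<nu>B"
  shows "linearly_bounded_below \<nu>A (\<lambda>a. \<nu>B (\<phi> a))"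
proof -
  obtain m t C D where "C > 0 \<and> D \<ge> 0 \<and> (\<forall>a x. - ereal x \<le> \<nu>A a \<longrightarrow>
      a \<in> A.span (monom_at m t ` {k \<in> exps m. real (total_deg m k) \<le> C * x + D}))"
    using admissible_generators[OF A.field_algebra_axioms assms(2)] by (elim exE) (rule that)
  then have genA: "a \<in> A.span (monom_at m t ` {k \<in> exps m. real (total_deg m k) \<le> C * x + D})"
    if "- ereal x \<le> \<nu>A a" for a x
    using that by simp
  obtain n y C' D' where CD: "C' > 0 \<and> D' \<ge> 0 \<and> (\<forall>b x. - ereal x \<le> \<nu>B b \<longrightarrow>
      b \<in> B.span (monom_at n y ` {k \<in> exps n. real (total_deg n k) \<le> C' * x + D'}))"
    using admissible_generators[OF B.field_algebra_axioms assms(3)] by (elim exE) (rule that)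
  then have C': "C' > 0" "D' \<ge> 0" by simp_all
  from CD have genB: "b \<in> B.span (monom_at n y ` {k \<in> exps n. real (total_deg n k) \<le> C' * x + D'})"
    if "- ereal x \<le> \<nu>B b" for b x
    using that by simp
  obtain d e where de: "d \<ge> 0 \<and> e > 0 \<and> (\<forall>N a.
      a \<in> A.span (monom_at m t ` {k. real (total_deg m k) \<le> N}) \<longrightarrow> - ereal (d + e * N) \<le> \<nu>A a)"
    using admissible_span_bound[OF A.field_algebra_axioms assms(2), of m t]
    by (elim exE) (rule that)
  then have d: "d \<ge> 0" "e > 0" by simp_all
  from de have bound: "- ereal (d + e * N) \<le> \<nu>A a"
    if "a \<in> A.span (monom_at m t ` {k. real (total_deg m k) \<le> N})" for N a
    using that by simp
  define z where "z = (\<lambda>i. if i < n then y i else \<phi> (t (i - n)))"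
  let ?r = "n + m"
  define T where "T = {k \<in> exps ?r. \<forall>i<n. Poly_Mapping.lookup k i = 0}"
  obtain E where E0: "1 \<le> E \<and> (\<forall>N T b. T \<subseteq> exps ?r \<longrightarrow> (\<forall>v\<in>T. \<forall>u\<in>exps ?r. u < v \<longrightarrow> u \<in> T) \<longrightarrow>
     b \<in> B.span (monom_at ?r z ` {k \<in> exps ?r. total_deg ?r k \<le> N}) \<longrightarrow>
     b \<in> B.span (monom_at ?r z ` T) \<longrightarrow>
     b \<in> B.span (monom_at ?r z ` {k \<in> T. total_deg ?r k \<le> E * N}))"
    using B.span_elimination_bound[of ?r z] by (elim exE) (rule that)
  then have E: "1 \<le> E" ..
  note elim = E0[THEN conjunct2, rule_format]
  have prod_split: "(\<Prod>i<n + m. g i) = (\<Prod>i<n. g i) * (\<Prod>i<m. g (n + i))" for g :: "nat \<Rightarrow> 'b"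
    by (induction m) (auto simp: mult.assoc)
  have sum_split: "(\<Sum>i<n + m. g i) = (\<Sum>i<n. g i) + (\<Sum>i<m. g (n + i))" for g :: "nat \<Rightarrow> nat"
    by (induction m) auto
  have monom_B: "monom_at ?r z k = monom_at n y k" "total_deg ?r k = total_deg n k"
    "k \<in> exps ?r" if "k \<in> exps n" for k
    using that unfolding monom_at_def prod_split sum_split by (auto simp: z_def exps_iff)
  have monom_A: "monom_at ?r z k = \<phi> (monom_at m t k')" "total_deg ?r k = total_deg m k'"
    if "k \<in> T" "\<forall>i<m. Poly_Mapping.lookup k' i = Poly_Mapping.lookup k (n + i)" for k k'
    using that unfolding hom_monom_at unfolding monom_at_def prod_split sum_split by (auto simp: z_def T_def)
  have T_down: "\<forall>v\<in>T. \<forall>u\<in>exps ?r. u < v \<longrightarrow> u \<in> T"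
  proof (intro ballI impI)
    fix u v assume v: "v \<in> T" and u: "u \<in> exps ?r" "u < v"
    from u(2) obtain i where i: "Poly_Mapping.lookup u i < Poly_Mapping.lookup v i"
      "\<And>j. j < i \<Longrightarrow> Poly_Mapping.lookup u j = Poly_Mapping.lookup v j" 
      using lex_lessE[OF u(2)] by blast
    have "n \<le> i" using i(1) v by (force simp: T_def not_less[symmetric])
    then show "u \<in> T" using i(2) u(1) v by (auto simp: T_def)
  qed
  have in_T: "\<phi> a \<in> B.span (monom_at ?r z ` T)" for a
  proof -
    have "\<exists>x. - ereal x \<le> \<nu>A a"
    proof (cases "\<nu>A a")
      case (real w)
      then show ?thesis by (intro exI[of _ "- w"]) simp
    next
      case MInf
      then show ?thesis
        using assms(2) by (simp add: admissible_def negative_pseudovaluation_def proper_pseudovaluation_def)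
    qed auto
    then obtain x where "- ereal x \<le> \<nu>A a" ..
    from genA[OF this] have "a \<in> A.span (monom_at m t ` exps m)"
      by (rule rev_subsetD[OF _ A.span_mono]) auto
    then have "\<phi> a \<in> B.span (\<phi> ` monom_at m t ` exps m)"
      unfolding linear.span_image by blast
    also have "\<dots> \<subseteq> B.span (monom_at ?r z ` T)"
    proof (intro B.span_mono image_subsetI, clarify)
      fix k' assume "k' \<in> exps m"
      obtain k where k: "k \<in> exps ?r" "\<forall>i<?r. Poly_Mapping.lookup k i =
          (if i < n then 0 else Poly_Mapping.lookup k' (i - n))"
        using exps_exists[of ?r "\<lambda>i. if i < n then 0 else Poly_Mapping.lookup k' (i - n)"] by blast
      then have "k \<in> T" by (auto simp: T_def)
      moreover from this k(2) have "monom_at ?r z k = \<phi> (monom_at m t k')" by (intro monom_A) auto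
      ultimately show "\<phi> (monom_at m t k') \<in> monom_at ?r z ` T" by (metis imageI)
    qed
    finally show ?thesis .
  qed
  have "- ereal (e * (E * C') * x + (d + e * (E * D'))) \<le> \<nu>A a"
    if x: "0 \<le> x" "- ereal x \<le> \<nu>B (\<phi> a)" for a x
  proof -
    define N where "N = nat \<lfloor>C' * x + D'\<rfloor>"
    have nonneg: "0 \<le> C' * x + D'" using x C' by simp
    have "monom_at n y ` {k \<in> exps n. real (total_deg n k) \<le> C' * x + D'}
        \<subseteq> monom_at ?r z ` {k \<in> exps ?r. total_deg ?r k \<le> N}"
    proof clarify
      fix k assume k: "k \<in> exps n" "real (total_deg n k) \<le> C' * x + D'"
      then have "total_deg n k \<le> N" unfolding N_def by (simp add: le_nat_floor)
      then show "monom_at n y k \<in> monom_at ?r z ` {k \<in> exps ?r. total_deg ?r k \<le> N}"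
        using monom_B[OF k(1)] by (intro image_eqI[of _ _ k]) auto
    qed
    then have "\<phi> a \<in> B.span (monom_at ?r z ` {k \<in> exps ?r. total_deg ?r k \<le> N})"
      using genB[OF x(2)] B.span_mono by blast
    then have "\<phi> a \<in> B.span (monom_at ?r z ` {k \<in> T. total_deg ?r k \<le> E * N})"
      using elim[of T b N for b, OF _ T_down[rule_format] _ in_T] by (simp add: T_def)
    also have "\<dots> \<subseteq> B.span (\<phi> ` monom_at m t ` {k. real (total_deg m k) \<le> E * (C' * x + D')})"
    proof (intro B.span_mono image_subsetI)
      fix k assume "k \<in> {k \<in> T. total_deg ?r k \<le> E * N}"
      then have k: "k \<in> T" "total_deg ?r k \<le> E * N" by auto
      obtain k' where k': "\<forall>i<m. Poly_Mapping.lookup k' i = Poly_Mapping.lookup k (n + i)"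
        using exps_exists[of m "\<lambda>i. Poly_Mapping.lookup k (n + i)"] by blast
      have "real (total_deg m k') \<le> real (E * N)"
        using k(2) unfolding monom_A(2)[OF k(1) k'] by (rule of_nat_mono)
      also have "\<dots> \<le> E * (C' * x + D')"
        using nonneg unfolding N_def of_nat_mult by (intro mult_left_mono) auto
      finally show "monom_at ?r z k \<in> \<phi> ` monom_at m t ` {k. real (total_deg m k) \<le> E * (C' * x + D')}"
        unfolding monom_A(1)[OF k(1) k'] by blast
    qed
    finally have "a \<in> A.span (monom_at m t ` {k. real (total_deg m k) \<le> E * (C' * x + D')})"
      unfolding linear.span_image inj_image_mem_iff[OF assms(1)] .
    from bound[OF this] show ?thesis by (simp add: algebra_simps)
  qed
  moreover have "e * (E * C') > 0" "d + e * (E * D') \<ge> 0" using d E C' by auto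
  ultimately show ?thesis unfolding linearly_bounded_below_def
    by (intro exI[of _ "e * (E * C')"] exI[of _ "d + e * (E * D')"] conjI allI impI)
qed

end

theorem proposition2p16:
  fixes \<iota>A :: "'k::field \<Rightarrow> 'a::comm_ring_1"
    and \<iota>B :: "'k \<Rightarrow> 'b::comm_ring_1"
    and \<phi> :: "'a \<Rightarrow> 'b"
    and \<nu>A :: "'a \<Rightarrow> ereal"
    and \<nu>B :: "'b \<Rightarrow> ereal"
    and p :: nat
  assumes "CHAR('k) = p" and "p > 0"
    and "fg_algebra \<iota>A" and "fg_algebra \<iota>B"
    and "\<phi> \<in> ring_hom ring_of_type_algebra ring_of_type_algebra"
    and "\<And>c. \<phi> (\<iota>A c) = \<iota>B c"
    and "inj \<phi>"
    and "smooth_hom \<phi>"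
    and "admissible \<iota>A \<nu>A" and "admissible \<iota>B \<nu>B"
  shows "range (witt_map \<phi>) \<inter> overconvergent_witt p \<nu>B
           = witt_map \<phi> ` overconvergent_witt p \<nu>A"
proof -
  interpret A: field_algebra \<iota>A by (rule field_algebra_of_fg) fact
  interpret B: field_algebra \<iota>B by (rule field_algebra_of_fg) fact
  interpret algebra_hom \<iota>A \<iota>B \<phi>
    using ring_hom_add[OF assms(5)] ring_hom_mult[OF assms(5)] ring_hom_one[OF assms(5)] assms(6)
    by unfold_locales (auto simp: ring_of_type_algebra_def)
  have "witt_map \<phi> \<alpha> \<in> overconvergent_witt p \<nu>B \<longleftrightarrow> \<alpha> \<in> overconvergent_witt p (\<lambda>a. \<nu>B (\<phi> a))" for \<alpha>
    by (simp add: overconvergent_witt_def witt_radius_def gauss_norm_def witt_map_def)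
  moreover have "\<alpha> \<in> overconvergent_witt p (\<lambda>a. \<nu>B (\<phi> a)) \<longleftrightarrow> \<alpha> \<in> overconvergent_witt p \<nu>A" for \<alpha>
    using overconvergent_witt_mono[OF admissible_pullback_bounded_below[OF assms(9,10)] assms(2)]
      overconvergent_witt_mono[OF admissible_descent_bounded_below[OF assms(7,9,10)] assms(2)] by blast
  ultimately show ?thesis by auto
qed

end
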